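(* Let $p_1,p_2>0$ and $q$ be real numbers with $1<\max(p_1,p_2)<q<\infty$, and let $u,v_1,v_2\in\mathfrak{M}^{+}$ be weights on $(0,\infty)$. Then there is a finite constant $C>0$ such that the inequality $$\left(\int_0^\infty (Tf)^q(x)\,(Tg)^q(x)\,u(x)\,dx\right)^{\frac1q}\le C\left(\int_0^\infty f^{p_1}(x)v_1(x)\,dx\right)^{\frac1{p_1}}\left(\int_0^\infty g^{p_2}(x)v_2(x)\,dx\right)^{\frac1{p_2}}$$ holds for all $f,g\in\mathfrak{M}^{+}$ if and only if $$\sup_{t>0}\,t^{-\left(\frac1{p_1}+\frac1{p_2}\right)}\left(\int_0^t\left[T\left(\frac1{v_1}\right)(x)\right]^{\frac q{p_1}}\left[T\left(\frac1{v_2}\right)(x)\right]^{\frac q{p_2}}u(x)\,dx\right)^{\frac1q}<\infty.$$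
   Context: $\mathfrak{M}^{+}$ is the set of non-negative Lebesgue measurable functions on $(0,\infty)$. $T$ is the geometric mean operator $(Tf)(x):=\exp\left(\frac1x\int_0^x\ln f(t)\,dt\right)$, $x>0$, for $f\in\mathfrak{M}^{+}$, with the usual conventions $\ln 0=-\infty$, $\exp(-\infty)=0$.
   Formalization: The inequality is required only for f, g whose two right-hand factors are not 0 and ∞: with 0·∞ = 0 the claim fails, e.g. for v1 = exp(1/t), v2 = indicator of (1,∞), u = 1. Nothing changes if v1, v2 > 0 a.e. Where Tf would involve ∞ − ∞, it is taken as ∞. *)

theory Defs
  imports "HOL-Analysis.Analysis"
begin

text \<open>
  Functions take values in \<open>[0,\<infinity>]\<close> (type \<^typ>\<open>ennreal\<close>), so that \<open>1/v\<close> makes sense for a weight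
  with zeros. The library arithmetic gives \<open>1/0 = \<infinity>\<close>, \<open>1/\<infinity> = 0\<close> and \<open>0 \<sqdot> \<infinity> = 0\<close>, the last being
  the usual convention for products under an integral sign.
\<close>

definition Mplus :: "(real \<Rightarrow> ennreal) set" where
  "Mplus = borel_measurable (lebesgue_on {0<..})"

text \<open>Intended for \<open>a > 0\<close> only: then \<open>0\<close> is sent to \<open>0\<close> and \<open>\<infinity>\<close> to \<open>\<infinity>\<close>.\<close>

definition enn_powr :: "ennreal \<Rightarrow> real \<Rightarrow> ennreal" (infixr \<open>epowr\<close> 80) where
  "y epowr a = (if y = \<infinity> then \<infinity> else ennreal (enn2real y powr a))"

definition eln :: "ennreal \<Rightarrow> ereal" where
  "eln y = (if y = 0 then -\<infinity> else if y = \<infinity> then \<infinity> else ereal (ln (enn2real y)))"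

definition eexp :: "ereal \<Rightarrow> ennreal" where
  "eexp z = (case z of ereal r \<Rightarrow> ennreal (exp r) | PInfty \<Rightarrow> \<infinity> | MInfty \<Rightarrow> 0)"

text \<open>
  The integral of an extended real function over \<open>(0,x)\<close> as the difference of the integrals of
  its positive and negative parts; \<^const>\<open>e2ennreal\<close> sends negative arguments to \<open>0\<close>. If both parts
  have infinite integral, the value is \<open>\<infinity> - \<infinity> = \<infinity>\<close> by the library convention for \<^typ>\<open>ereal\<close>.
\<close>

definition eintegral0 :: "(real \<Rightarrow> ereal) \<Rightarrow> real \<Rightarrow> ereal" where
  "eintegral0 h x =
     enn2ereal (\<integral>\<^sup>+t\<in>{0<..<x}. e2ennreal (h t) \<partial>lebesgue)
   - enn2ereal (\<integral>\<^sup>+t\<in>{0<..<x}. e2ennreal (- h t) \<partial>lebesgue)"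

definition geom_mean :: "(real \<Rightarrow> ennreal) \<Rightarrow> real \<Rightarrow> ennreal" where
  "geom_mean f x = eexp (eintegral0 (\<lambda>t. eln (f t)) x / ereal x)"

definition weighted_norm :: "real \<Rightarrow> (real \<Rightarrow> ennreal) \<Rightarrow> (real \<Rightarrow> ennreal) \<Rightarrow> ennreal" where
  "weighted_norm p v f = (\<integral>\<^sup>+x\<in>{0<..}. (f x epowr p) * v x \<partial>lebesgue) epowr (1 / p)"

text \<open>
  A product of two norms of the form \<open>0 \<sqdot> \<infinity>\<close> is not a meaningful upper bound. Reading it as \<open>0\<close>
  would make the characterization below fail for degenerate weights: with
  \<open>v\<^sub>1(t) = exp (1/t)\<close>, \<open>v\<^sub>2\<close> the indicator of \<open>(1,\<infinity>)\<close> and \<open>u = 1\<close> the supremum is \<open>0\<close>, while \<open>f = 1\<close>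
  and \<open>g\<close> the indicator of \<open>(0,1)\<close> have norms \<open>\<infinity>\<close> and \<open>0\<close> and a positive left-hand side.
  If \<open>v\<^sub>1, v\<^sub>2 > 0\<close> almost everywhere the reading is irrelevant: a factor is then \<open>0\<close> only if
  its function vanishes almost everywhere, and so the left-hand side is \<open>0\<close>.
\<close>

definition indeterminate_product :: "ennreal \<Rightarrow> ennreal \<Rightarrow> bool" where
  "indeterminate_product a b \<longleftrightarrow> (a = 0 \<and> b = \<infinity>) \<or> (a = \<infinity> \<and> b = 0)"

end

theory Submission
  imports Defs
begin

text \<open>
  Necessity: test with \<open>f = v\<^sub>1\<close> to the power \<open>-1/p\<^sub>1\<close> times the indicator of \<open>(0,t)\<close>, and likewise for \<open>g\<close>.

  Sufficiency: the tangent bound \<open>ln y \<le> ln c + y/c\<close>, applied to \<open>y = t F(t)\<close> with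
  \<open>F = f\<^sup>p v\<close>, gives \<open>(T f)\<^sup>p(x) \<le> T(1/v)(x) \<cdot> C x\<^sup>-\<^sup>2 \<integral>\<^sub>0\<^sup>x t F(t) dt\<close>. The moment is at most \<open>x\<close> times
  the full integral of \<open>F\<close>; this estimate is used for \<open>g\<close> and for all but one power of the moment
  of \<open>f\<close>. What remains is linear in \<open>F\<close>, and Tonelli's theorem reduces it to a
  tail bound for the combined weight \<open>w = T(1/v\<^sub>1)\<^sup>a T(1/v\<^sub>2)\<^sup>b u\<close>, where \<open>a = q/p\<^sub>1\<close> and \<open>b = q/p\<^sub>2\<close>.
\<close>

section \<open>Powers, logarithm and exponential on the extended half-line\<close>

lemma epowr_0 [simp]: "0 epowr a = 0"
  by (simp add: enn_powr_def)

lemma epowr_top [simp]: "top epowr a = top"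
  by (simp add: enn_powr_def)

lemma epowr_ennreal: "0 \<le> r \<Longrightarrow> ennreal r epowr a = ennreal (r powr a)"
  by (simp add: enn_powr_def)

lemma epowr_eq_top_iff [simp]: "y epowr a = top \<longleftrightarrow> y = top"
  by (simp add: enn_powr_def)

lemma epowr_eq_0_iff [simp]: "y epowr a = 0 \<longleftrightarrow> y = 0"
  by (cases y) (auto simp: epowr_ennreal)

lemma epowr_1 [simp]: "y epowr 1 = y"
  by (cases y) (auto simp: epowr_ennreal)

lemma epowr_mono: "y \<le> z \<Longrightarrow> 0 \<le> a \<Longrightarrow> y epowr a \<le> z epowr a"
  by (cases y; cases z) (auto simp: epowr_ennreal top_unique intro!: ennreal_leI powr_mono2)

text \<open>Holds for every real \<open>a\<close>, not only positive ones: \<open>epowr\<close>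
  fixes both 0 and \<open>top\<close>, whatever the exponent, and \<open>0 * top = 0\<close>. Only
  monotonicity needs a sign condition on \<open>a\<close>.\<close>

lemma epowr_mult: "(y * z) epowr a = y epowr a * z epowr a"
proof (cases "y = 0 \<or> z = 0")
  case False
  then show ?thesis
    by (cases y; cases z)
      (auto simp: epowr_ennreal ennreal_mult[symmetric] powr_mult ennreal_mult_top ennreal_top_mult)
qed auto

lemma epowr_epowr: "(y epowr a) epowr b = y epowr (a * b)"
  by (cases y) (auto simp: epowr_ennreal powr_powr)

lemma epowr_add: "y epowr a * y epowr b = y epowr (a + b)"
  by (cases y) (auto simp: epowr_ennreal ennreal_mult[symmetric] powr_add)

lemma measurable_epowr [measurable]: "(\<lambda>y. y epowr a) \<in> borel_measurable borel"
  unfolding enn_powr_def by measurable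

lemma measurable_eln [measurable]: "eln \<in> borel_measurable borel"
  unfolding eln_def by measurable

lemma eln_0 [simp]: "eln 0 = -\<infinity>"
  and eln_top [simp]: "eln top = \<infinity>"
  and eln_ennreal: "0 < r \<Longrightarrow> eln (ennreal r) = ereal (ln r)"
  by (auto simp: eln_def)

lemma eln_epowr:
  assumes "0 < a"
  shows "eln (y epowr a) = ereal a * eln y"
proof (cases y)
  case (real r)
  then show ?thesis
    using assms by (cases "r = 0") (auto simp: epowr_ennreal eln_ennreal ln_powr)
qed (use assms in auto)

lemma eexp_ereal [simp]: "eexp (ereal r) = ennreal (exp r)"
  and eexp_infty [simp]: "eexp \<infinity> = top"
  and eexp_minus_infty [simp]: "eexp (-\<infinity>) = 0"
  by (simp_all add: eexp_def)

lemma measurable_eexp [measurable]: "eexp \<in> borel_measurable borel"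
proof -
  have eq: "eexp z = (if z = \<infinity> then top else if z = -\<infinity> then 0
                     else ennreal (exp (real_of_ereal z)))" for z
    by (cases z) auto
  show ?thesis
    unfolding eq [abs_def] by measurable
qed

lemma eexp_mult_ereal:
  assumes "0 < a"
  shows "eexp (ereal a * z) = eexp z epowr a"
  using assms by (cases z) (auto simp: epowr_ennreal powr_def mult.commute)

text \<open>Truncation at 0 commutes with a positive factor, so the positive and negative parts of a
  logarithm can be scaled separately.\<close>

lemma e2ennreal_ereal_mult:
  assumes "0 < a"
  shows "e2ennreal (ereal a * z) = ennreal a * e2ennreal z"
proof (cases z)
  case (real r)
  then show ?thesis
    using assms by (cases "0 \<le> r") (auto simp: ennreal_mult ennreal_neg mult_nonneg_nonpos)
next
  case PInf
  then show ?thesis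
    using assms by (simp add: ennreal_mult_top)
next
  case MInf
  then show ?thesis
    using assms by (simp add: e2ennreal_neg)
qed

section \<open>The geometric mean operator\<close>

lemma measurable_lebesgue_borel [measurable]: "(\<lambda>x. x) \<in> lebesgue \<rightarrow>\<^sub>M (borel :: real measure)"
  by (simp add: measurable_completion)

text \<open>Sigma-finiteness is what Tonelli's theorem and the measurability of integrals with a
  parameter require. Balls of integer radius exhaust the line.\<close>

lemma sigma_finite_lebesgue: "sigma_finite_measure (lebesgue :: real measure)"
proof
  have "emeasure lebesgue (cball (0::real) (real n)) \<noteq> \<infinity>" for n
    using emeasure_bounded_finite[of "cball (0::real) (real n)"] by simp
  moreover have "(\<Union>n. cball (0::real) (real n)) = space lebesgue"
    by (auto simp: dist_norm intro: real_arch_simple)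
  ultimately show "\<exists>A. countable A \<and> A \<subseteq> sets lebesgue \<and> \<Union>A = space (lebesgue :: real measure) \<and>
      (\<forall>a\<in>A. emeasure lebesgue a \<noteq> \<infinity>)"
    by (intro exI[of _ "range (\<lambda>n::nat. cball (0::real) (real n))"]) auto
qed

text \<open>Members of \<open>Mplus\<close> may be arbitrary on the non-positive half-line. After a
  cut-off they are measurable on the whole line, so that all integrals can be taken over
  \<open>lebesgue\<close>.\<close>

lemma Mplus_indicator:
  assumes "\<phi> \<in> Mplus" "A \<in> sets lebesgue" "A \<subseteq> {0<..}"
  shows "(\<lambda>t. \<phi> t * indicator A t) \<in> borel_measurable lebesgue"
proof -
  have [measurable]: "(\<lambda>t. \<phi> t * indicator {0<..} t) \<in> borel_measurable lebesgue"
    using assms(1) by (simp add: Mplus_def borel_measurable_restrict_space_iff_ennreal)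
  have "(\<lambda>t. (\<phi> t * indicator {0<..} t) * indicator A t) \<in> borel_measurable lebesgue"
    using assms(2) by measurable
  also have "(\<lambda>t. (\<phi> t * indicator {0<..} t) * indicator A t) = (\<lambda>t. \<phi> t * indicator A t)"
    using assms(3) by (fastforce simp: indicator_def)
  finally show ?thesis .
qed

lemma Mplus_interval:
  assumes "\<phi> \<in> Mplus"
  shows "(\<lambda>t. \<phi> t * indicator {0<..<x} t) \<in> borel_measurable lebesgue"
    and "(\<lambda>t. \<phi> t * indicator {0<..} t) \<in> borel_measurable lebesgue"
  using assms by (auto intro!: Mplus_indicator)

lemma Mplus_compose: "\<phi> \<in> Mplus \<Longrightarrow> H \<in> borel_measurable borel \<Longrightarrow> (\<lambda>t. H (\<phi> t)) \<in> Mplus"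
  unfolding Mplus_def by (rule measurable_compose)

lemma Mplus_eln:
  assumes "\<phi> \<in> Mplus"
  shows "(\<lambda>t. e2ennreal (eln (\<phi> t))) \<in> Mplus" "(\<lambda>t. e2ennreal (- eln (\<phi> t))) \<in> Mplus"
  using assms by (auto intro!: Mplus_compose[of \<phi>])

lemma Mplus_mult: "\<phi> \<in> Mplus \<Longrightarrow> \<psi> \<in> Mplus \<Longrightarrow> (\<lambda>t. \<phi> t * \<psi> t) \<in> Mplus"
  unfolding Mplus_def by measurable

lemma Mplus_borel: "H \<in> borel_measurable borel \<Longrightarrow> H \<in> Mplus"
  unfolding Mplus_def by (intro measurable_restrict_space1 measurable_completion) simp

lemma Mplus_one_divide: "\<phi> \<in> Mplus \<Longrightarrow> (\<lambda>t. 1 / \<phi> t) \<in> Mplus"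
  by (rule Mplus_compose) measurable

lemma measurable_integral_upto:
  assumes "\<phi> \<in> Mplus"
  shows "(\<lambda>x. \<integral>\<^sup>+t\<in>{0<..<x}. \<phi> t \<partial>lebesgue) \<in> borel_measurable lebesgue"
proof -
  interpret sigma_finite_measure "lebesgue :: real measure"
    by (rule sigma_finite_lebesgue)
  have [measurable]: "(\<lambda>t. \<phi> t * indicator {0<..} t) \<in> borel_measurable lebesgue"
    using assms by (rule Mplus_interval)
  \<comment> \<open>With the interval written as the condition \<open>t < x\<close>, the integrand
    is jointly measurable in both variables.\<close>
  have "(\<lambda>x. \<integral>\<^sup>+t. (if t < x then \<phi> t * indicator {0<..} t else 0) \<partial>lebesgue)
          \<in> borel_measurable lebesgue"
    by measurable
  also have "(\<lambda>x t. if t < x then \<phi> t * indicator {0<..} t else 0)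
      = (\<lambda>x t. \<phi> t * indicator {0<..<x} t)"
    by (auto simp: indicator_def fun_eq_iff)
  finally show ?thesis .
qed

lemma geom_mean_Mplus:
  assumes "f \<in> Mplus"
  shows "geom_mean f \<in> Mplus"
proof -
  note [measurable] = Mplus_eln[OF assms, THEN measurable_integral_upto]
  have "geom_mean f \<in> borel_measurable lebesgue"
    unfolding geom_mean_def eintegral0_def by measurable
  then show ?thesis
    unfolding Mplus_def by (rule measurable_restrict_space1)
qed

lemma geom_mean_cong:
  assumes "\<And>t. 0 < t \<Longrightarrow> t < x \<Longrightarrow> f t = g t"
  shows "geom_mean f x = geom_mean g x"
proof -
  have "f t = g t" if "t \<in> {0<..<x}" for t
    using assms that by simp
  then show ?thesis
    unfolding geom_mean_def eintegral0_def
    by (intro arg_cong[where f = eexp] arg_cong2[where f = "(/)"] arg_cong2[where f = "(-)"]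
        arg_cong[where f = enn2ereal] nn_integral_cong refl) (auto simp: indicator_def)
qed

text \<open>Also true for \<infinity> - \<infinity>: this is \<infinity>, and a positive factor
  preserves it.\<close>

lemma ereal_mult_diff: "0 < a \<Longrightarrow> ereal a * (y - z) = ereal a * y - ereal a * z"
  by (cases y; cases z) (auto simp: right_diff_distrib)

text \<open>The exponent leaves the logarithm as a factor of the mean and becomes a power again
  under \<open>eexp\<close>. Thus estimates for general exponents reduce to the exponent 1.\<close>

lemma geom_mean_epowr:
  assumes "f \<in> Mplus" "0 < a" "0 < x"
  shows "geom_mean (\<lambda>t. f t epowr a) x = geom_mean f x epowr a"
proof -
  note [measurable] = Mplus_eln[OF assms(1), THEN Mplus_interval(1)]
  have "e2ennreal (- (ereal a * z)) = ennreal a * e2ennreal (- z)" for z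
    using e2ennreal_ereal_mult[OF assms(2), of "- z"] by simp
  then have "eintegral0 (\<lambda>t. eln (f t epowr a)) x
      = enn2ereal (ennreal a * (\<integral>\<^sup>+t\<in>{0<..<x}. e2ennreal (eln (f t)) \<partial>lebesgue))
      - enn2ereal (ennreal a * (\<integral>\<^sup>+t\<in>{0<..<x}. e2ennreal (- eln (f t)) \<partial>lebesgue))"
    using assms(2)
    by (simp add: eintegral0_def eln_epowr e2ennreal_ereal_mult nn_integral_cmult[symmetric] mult.assoc)
  also have "\<dots> = ereal a * eintegral0 (\<lambda>t. eln (f t)) x"
    unfolding eintegral0_def times_ennreal.rep_eq using assms(2)
    by (simp add: enn2ereal_ennreal ereal_mult_diff)
  finally have "geom_mean (\<lambda>t. f t epowr a) x
      = eexp (ereal a * (eintegral0 (\<lambda>t. eln (f t)) x / ereal x))"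
    by (simp add: geom_mean_def ereal_times_divide_eq)
  then show ?thesis
    using assms(2) by (simp add: eexp_mult_ereal geom_mean_def)
qed

section \<open>Pointwise bounds for the geometric mean\<close>

text \<open>The bound \<open>ln z \<le> 2 * z powr (1/2)\<close> for \<open>z \<ge> 1\<close>
  replaces the logarithm by an integrable power of \<open>t\<close>. The exact value is
  \<open>x\<close>, but any fixed multiple of \<open>x\<close> suffices.\<close>

lemma nn_integral_ln_ratio_le:
  assumes "0 < x"
  shows "(\<integral>\<^sup>+t\<in>{0<..<x}. ennreal (ln (x / t)) \<partial>lebesgue) \<le> ennreal (4 * x)"
proof -
  have "(\<integral>\<^sup>+t\<in>{0<..<x}. ennreal (ln (x / t)) \<partial>lebesgue)
      = (\<integral>\<^sup>+t\<in>{0<..<x}. ennreal (ln (x / t)) \<partial>lborel)"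
    by (rule nn_integral_completion)
  also have "\<dots> \<le> (\<integral>\<^sup>+t\<in>{0..x}. ennreal (2 * x powr (1/2) * t powr (-1/2)) \<partial>lborel)"
  proof (rule nn_integral_mono)
    fix t
    have "ln (x / t) \<le> 2 * x powr (1/2) * t powr (-1/2)" if "0 < t" "t < x"
      using ln_powr_bound[of "x / t" "1/2"] that
      by (simp add: powr_divide powr_minus_divide mult.commute)
    then show "ennreal (ln (x / t)) * indicator {0<..<x} t
        \<le> ennreal (2 * x powr (1/2) * t powr (-1/2)) * indicator {0..x} t"
      by (auto simp: indicator_def intro!: ennreal_leI)
  qed
  also have "\<dots> = ennreal (4 * x)"
  proof -
    have "((\<lambda>t. 2 * x powr (1/2) * t powr (-1/2)) has_integral
        2 * x powr (1/2) * (x powr (-1/2 + 1) / (-1/2 + 1))) {0..x}"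
      using assms by (intro has_integral_mult_right has_integral_powr_from_0) auto
    also have "2 * x powr (1/2) * (x powr (-1/2 + 1) / (-1/2 + 1)) = 4 * x"
      using assms by (simp flip: powr_add)
    finally show ?thesis
      using assms by (intro nn_integral_has_integral_lebesgue') auto
  qed
  finally show ?thesis .
qed

text \<open>The positive part of each logarithm is moved to the other side, so that no difference
  of infinite quantities can occur.\<close>

lemma log_tangent_bound:
  fixes y w :: ennreal
  assumes "0 < t" "t < x" "0 < K" "w \<noteq> 0" "y * w \<noteq> top"
  shows "e2ennreal (eln y) + e2ennreal (- eln (1 / w)) + ennreal (- ln (K / x\<^sup>2))
      \<le> e2ennreal (- eln y) + e2ennreal (eln (1 / w))
        + ennreal (x / K) * (ennreal t * (y * w)) + ennreal (ln (x / t)) + ennreal (ln (K / x\<^sup>2))"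
    and "e2ennreal (eln y) \<le> e2ennreal (eln (1 / w))
        + ennreal (x / K) * (ennreal t * (y * w)) + ennreal (ln (x / t)) + ennreal (ln (K / x\<^sup>2))"
proof -
  \<comment> \<open>If \<open>y = 0\<close>, the first right-hand side contains
    \<open>e2ennreal (- eln 0) = top\<close> and the second left-hand side is 0. Otherwise
    \<open>y * w\<close> is a finite product of nonzero factors, so both are finite.\<close>
  consider "y = 0" | r s where "y = ennreal r" "w = ennreal s" "0 < r" "0 < s"
  proof (cases "y = 0")
    case False
    with assms have "y \<noteq> top" "w \<noteq> top"
      by (auto simp: ennreal_mult_eq_top_iff)
    then show ?thesis
      using that(2)[of "enn2real y" "enn2real w"] False assms
      by (simp add: enn2real_positive_iff less_top[symmetric] zero_less_iff_neq_zero)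
  qed
  then have "(e2ennreal (eln y) + e2ennreal (- eln (1 / w)) + ennreal (- ln (K / x\<^sup>2))
      \<le> e2ennreal (- eln y) + e2ennreal (eln (1 / w))
        + ennreal (x / K) * (ennreal t * (y * w)) + ennreal (ln (x / t)) + ennreal (ln (K / x\<^sup>2))) \<and>
     e2ennreal (eln y) \<le> e2ennreal (eln (1 / w))
        + ennreal (x / K) * (ennreal t * (y * w)) + ennreal (ln (x / t)) + ennreal (ln (K / x\<^sup>2))"
  proof cases
    case 1
    then show ?thesis
      by (simp add: e2ennreal_neg)
  next
    case 2
    have eln: "eln y = ereal (ln r)" "eln (1 / w) = ereal (- ln s)"
      using 2 by (simp_all add: eln_ennreal divide_ennreal ln_div flip: ennreal_1)
    \<comment> \<open>This is \<open>ln z \<le> ln c + z/c\<close> for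
      \<open>z = t * (r * s)\<close> and \<open>c = K/x\<close>. When \<open>K\<close> bounds the
      moment over (0,x), this \<open>c\<close> bounds the mean of \<open>z\<close>, and the linear
      term integrates to at most \<open>x\<close>.\<close>
    have "ln (x * t * (r * s) / K) \<le> x * t * (r * s) / K"
      using assms 2 by (intro ln_bound) simp
    then have tangent: "ln r + ln s - ln (K / x\<^sup>2) \<le> x / K * (t * (r * s)) + ln (x / t)"
      using assms 2 by (simp add: ln_mult ln_div ln_realpow)
    have nonneg: "0 \<le> x / K * (t * (r * s))" "0 \<le> ln (x / t)"
      using assms 2 by auto
    have prod: "ennreal (x / K) * (ennreal t * (y * w)) = ennreal (x / K * (t * (r * s)))"
      using assms 2 by (simp flip: ennreal_mult)
    \<comment> \<open>\<open>ennreal\<close> truncates at 0. With the truncation made explicit, both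
      claims are real inequalities that follow from \<open>tangent\<close> by cases on
      signs.\<close>
    define pos :: "real \<Rightarrow> real" where "pos z = max 0 z" for z
    have pos: "ennreal z = ennreal (pos z)" "0 \<le> pos z" for z
      by (auto simp: pos_def max_def ennreal_neg)
    have "pos (ln r) + pos (- (- ln s)) + pos (- ln (K / x\<^sup>2))
        \<le> pos (- ln r) + pos (- ln s) + x / K * (t * (r * s)) + ln (x / t) + pos (ln (K / x\<^sup>2))"
      "pos (ln r) \<le> pos (- ln s) + x / K * (t * (r * s)) + ln (x / t) + pos (ln (K / x\<^sup>2))"
      using nonneg tangent unfolding pos_def max_def by argo+
    from this[THEN ennreal_leI] show ?thesis
      unfolding eln prod uminus_ereal.simps e2ennreal_ereal
      unfolding pos(1)[of "ln r"] pos(1)[of "- ln s"] pos(1)[of "- (- ln s)"] pos(1)[of "- ln r"]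
        pos(1)[of "ln (K / x\<^sup>2)"] pos(1)[of "- ln (K / x\<^sup>2)"]
      using nonneg pos(2) by (simp only: ennreal_plus add_nonneg_nonneg simp_thms)
  qed
  then show "e2ennreal (eln y) + e2ennreal (- eln (1 / w)) + ennreal (- ln (K / x\<^sup>2))
      \<le> e2ennreal (- eln y) + e2ennreal (eln (1 / w))
        + ennreal (x / K) * (ennreal t * (y * w)) + ennreal (ln (x / t)) + ennreal (ln (K / x\<^sup>2))"
    and "e2ennreal (eln y) \<le> e2ennreal (eln (1 / w))
        + ennreal (x / K) * (ennreal t * (y * w)) + ennreal (ln (x / t)) + ennreal (ln (K / x\<^sup>2))"
    by auto
qed

text \<open>An infinite positive part makes the difference \<infinity> whatever the negative part
  is, since \<infinity> - \<infinity> = \<infinity>.\<close>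

lemma geom_mean_not_top_pos_part:
  assumes "geom_mean f x \<noteq> top" "0 < x"
  shows "(\<integral>\<^sup>+t\<in>{0<..<x}. e2ennreal (eln (f t)) \<partial>lebesgue) \<noteq> top"
  using assms by (auto simp: geom_mean_def eintegral0_def)

text \<open>Applied to \<open>1 / v\<close>, this says that \<open>v\<close> vanishes almost nowhere
  on (0,x).\<close>

lemma geom_mean_not_top_AE:
  assumes "f \<in> Mplus" "geom_mean f x \<noteq> top" "0 < x"
  shows "AE t in lebesgue. t \<in> {0<..<x} \<longrightarrow> f t \<noteq> top"
proof -
  have "AE t in lebesgue. e2ennreal (eln (f t)) * indicator {0<..<x} t \<noteq> \<infinity>"
    using geom_mean_not_top_pos_part[OF assms(2,3)] Mplus_eln(1)[OF assms(1)]
    by (intro nn_integral_noteq_infinite Mplus_interval) simp_all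
  then show ?thesis
    by (rule AE_mp) (auto simp: indicator_def)
qed

text \<open>The tangent bound is integrated over (0,x), divided by \<open>x\<close> and
  exponentiated. The 5 in the constant is 1 from the linear term plus 4 from
  \<open>ln (x / t)\<close>.\<close>

lemma geom_mean_le_aux:
  assumes "f \<in> Mplus" "v \<in> Mplus" "0 < x" "0 < K"
    and G: "geom_mean (\<lambda>s. 1 / v s) x \<noteq> top"
    and K: "(\<integral>\<^sup>+t\<in>{0<..<x}. ennreal t * (f t * v t) \<partial>lebesgue) \<le> ennreal K"
  shows "geom_mean f x \<le> geom_mean (\<lambda>s. 1 / v s) x * ennreal (exp 5 * K / x\<^sup>2)"
proof -
  let ?v = "\<lambda>s. 1 / v s"
  let ?I = "\<lambda>\<phi>. \<integral>\<^sup>+t\<in>{0<..<x}. \<phi> t \<partial>lebesgue"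
  define a where "a = ?I (\<lambda>t. e2ennreal (eln (f t)))"
  define b where "b = ?I (\<lambda>t. e2ennreal (- eln (f t)))"
  define c where "c = ?I (\<lambda>t. e2ennreal (eln (?v t)))"
  define d where "d = ?I (\<lambda>t. e2ennreal (- eln (?v t)))"
  have Mplus: "(\<lambda>t. e2ennreal (eln (f t))) \<in> Mplus" "(\<lambda>t. e2ennreal (- eln (f t))) \<in> Mplus"
    "(\<lambda>t. e2ennreal (eln (?v t))) \<in> Mplus" "(\<lambda>t. e2ennreal (- eln (?v t))) \<in> Mplus"
    "(\<lambda>t. ennreal t * (f t * v t)) \<in> Mplus" "(\<lambda>t. ennreal (ln (x / t))) \<in> Mplus"
    using Mplus_eln[OF assms(1)] Mplus_eln[OF Mplus_one_divide[OF assms(2)]]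
      Mplus_mult[OF Mplus_borel[OF measurable_ennreal] Mplus_mult[OF assms(1,2)]]
      Mplus_borel[of "\<lambda>t. ennreal (ln (x / t))"]
    by simp_all
  note [measurable] = this[THEN Mplus_interval(1)]
  have "AE t in lebesgue. ennreal t * (f t * v t) * indicator {0<..<x} t \<noteq> \<infinity>"
  proof (rule nn_integral_noteq_infinite)
    show "?I (\<lambda>t. ennreal t * (f t * v t)) \<noteq> \<infinity>"
      using K by (auto simp: top_unique)
  qed measurable
  moreover have "AE t in lebesgue. t \<in> {0<..<x} \<longrightarrow> ?v t \<noteq> top"
    using assms by (intro geom_mean_not_top_AE Mplus_one_divide)
  ultimately have AE: "AE t in lebesgue. t \<in> {0<..<x} \<longrightarrow> v t \<noteq> 0 \<and> f t * v t \<noteq> top"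
    by eventually_elim (auto simp: ennreal_mult_top)
  define \<kappa> where "\<kappa> = ln (K / x\<^sup>2)"
  have const: "?I (\<lambda>t. ennreal z) = ennreal z * ennreal x" for z
    using \<open>0 < x\<close> by (simp add: nn_integral_cmult_indicator)
  have part: "?I (\<lambda>t. ennreal (x / K) * (ennreal t * (f t * v t))) \<le> ennreal x"
  proof -
    have "?I (\<lambda>t. ennreal (x / K) * (ennreal t * (f t * v t)))
        = ennreal (x / K) * ?I (\<lambda>t. ennreal t * (f t * v t))"
      unfolding mult.assoc[of "ennreal (x / K)"] by (intro nn_integral_cmult) measurable
    also have "\<dots> \<le> ennreal (x / K) * ennreal K"
      by (intro mult_left_mono K) auto
    finally show ?thesis
      using assms by (simp flip: ennreal_mult)
  qed
  have "a + d + ennreal (- \<kappa>) * ennreal x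
      = ?I (\<lambda>t. e2ennreal (eln (f t)) + e2ennreal (- eln (?v t)) + ennreal (- \<kappa>))"
    unfolding a_def d_def const[symmetric] distrib_right
    by (simp add: nn_integral_add)
  also have "\<dots> \<le> ?I (\<lambda>t. e2ennreal (- eln (f t)) + e2ennreal (eln (?v t))
        + ennreal (x / K) * (ennreal t * (f t * v t)) + ennreal (ln (x / t)) + ennreal \<kappa>)"
    using AE unfolding \<kappa>_def
  proof (intro nn_integral_mono_AE, eventually_elim)
    case (elim t)
    then show ?case
      using log_tangent_bound(1)[of t x K "v t" "f t"] \<open>0 < K\<close>
      by (cases "t \<in> {0<..<x}") simp_all
  qed
  also have "\<dots> = b + c + ?I (\<lambda>t. ennreal (x / K) * (ennreal t * (f t * v t)))
        + ?I (\<lambda>t. ennreal (ln (x / t))) + ennreal \<kappa> * ennreal x"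
    unfolding b_def c_def const[symmetric] distrib_right
    by (simp add: nn_integral_add mult.assoc[of "ennreal (x / K)"])
  also have "\<dots> \<le> b + c + ennreal x + ennreal (4 * x) + ennreal \<kappa> * ennreal x"
    by (intro add_mono order_refl part nn_integral_ln_ratio_le \<open>0 < x\<close>)
  finally have main: "a + d + ennreal (- \<kappa>) * ennreal x
      \<le> b + c + ennreal x + ennreal (4 * x) + ennreal \<kappa> * ennreal x" .
  \<comment> \<open>\<open>main\<close> has the possibly infinite \<open>b\<close> on its right and
    cannot show that \<open>a\<close> is finite. The second tangent bound avoids
    \<open>b\<close>.\<close>
  have "a \<le> ?I (\<lambda>t. e2ennreal (eln (?v t))
        + ennreal (x / K) * (ennreal t * (f t * v t)) + ennreal (ln (x / t)) + ennreal \<kappa>)"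
    using AE unfolding \<kappa>_def a_def
  proof (intro nn_integral_mono_AE, eventually_elim)
    case (elim t)
    then show ?case
      using log_tangent_bound(2)[of t x K "v t" "f t"] \<open>0 < K\<close>
      by (cases "t \<in> {0<..<x}") simp_all
  qed
  also have "\<dots> = c + ?I (\<lambda>t. ennreal (x / K) * (ennreal t * (f t * v t)))
        + ?I (\<lambda>t. ennreal (ln (x / t))) + ennreal \<kappa> * ennreal x"
    unfolding c_def const[symmetric] distrib_right
    by (simp add: nn_integral_add mult.assoc[of "ennreal (x / K)"])
  also have "\<dots> \<le> c + ennreal x + ennreal (4 * x) + ennreal \<kappa> * ennreal x"
    by (intro add_mono order_refl part nn_integral_ln_ratio_le \<open>0 < x\<close>)
  finally have a_le: "a \<le> c + ennreal x + ennreal (4 * x) + ennreal \<kappa> * ennreal x" .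
  have "c \<noteq> top"
    unfolding c_def using G \<open>0 < x\<close> by (rule geom_mean_not_top_pos_part)
  then have "c + ennreal x + ennreal (4 * x) + ennreal \<kappa> * ennreal x \<noteq> top"
    by (simp add: ennreal_mult_eq_top_iff)
  with a_le have "a \<noteq> top"
    by (auto simp: top_unique)
  have gm: "geom_mean f x = eexp ((enn2ereal a - enn2ereal b) / ereal x)"
    "geom_mean ?v x = eexp ((enn2ereal c - enn2ereal d) / ereal x)"
    by (simp_all add: geom_mean_def eintegral0_def a_def b_def c_def d_def)
  show ?thesis
  \<comment> \<open>If \<open>b\<close> is infinite, the exponent is -\<infinity> because
    \<open>a\<close> is finite, and the left-hand side is 0. Otherwise \<open>main\<close> makes
    \<open>d\<close> finite, and all four integrals are real numbers.\<close>
  proof (cases "b = top")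
    case True
    then show ?thesis
      using \<open>a \<noteq> top\<close> \<open>0 < x\<close> by (cases a) (auto simp: gm)
  next
    case False
    with main \<open>c \<noteq> top\<close> have "d \<noteq> top"
      by (auto simp: ennreal_mult_eq_top_iff top_unique)
    define a' b' c' d' where "a' = enn2real a" "b' = enn2real b" "c' = enn2real c" "d' = enn2real d"
    then have eqs: "a = ennreal a'" "b = ennreal b'" "c = ennreal c'" "d = ennreal d'"
      and nonneg: "0 \<le> a'" "0 \<le> b'" "0 \<le> c'" "0 \<le> d'"
      using \<open>a \<noteq> top\<close> False \<open>c \<noteq> top\<close> \<open>d \<noteq> top\<close> by (simp_all add: less_top)
    define pos :: "real \<Rightarrow> real" where "pos z = max 0 (z * x)" for z
    have pos: "ennreal z * ennreal x = ennreal (pos z)" "0 \<le> pos z" for z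
      using \<open>0 < x\<close> by (cases "0 \<le> z")
        (auto simp: pos_def max_def ennreal_neg ennreal_mult zero_le_mult_iff mult_le_0_iff)
    have "ennreal (a' + d' + pos (- \<kappa>)) \<le> ennreal (b' + c' + x + 4 * x + pos \<kappa>)"
      using main nonneg \<open>0 < x\<close> unfolding eqs pos
      by (simp only: ennreal_plus add_nonneg_nonneg pos mult_nonneg_nonneg less_imp_le zero_le_numeral)
    moreover have "0 \<le> b' + c' + x + 4 * x + pos \<kappa>"
      using nonneg \<open>0 < x\<close> pos(2)[of \<kappa>] by simp
    ultimately have "a' + d' + pos (- \<kappa>) \<le> b' + c' + x + 4 * x + pos \<kappa>"
      by (simp only: ennreal_le_iff)
    \<comment> \<open>Uses \<open>pos \<kappa> - pos (- \<kappa>) = \<kappa> * x\<close>.\<close>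
    then have "a' - b' \<le> (c' - d') + (5 + \<kappa>) * x"
      by (simp add: pos_def max_def algebra_simps split: if_splits)
    then have "(a' - b') / x \<le> (c' - d') / x + (5 + \<kappa>)"
      using \<open>0 < x\<close> divide_right_mono[of "a' - b'" _ x] by (fastforce simp: add_divide_distrib)
    then have "exp ((a' - b') / x) \<le> exp ((c' - d') / x + (5 + \<kappa>))"
      by simp
    also have "\<dots> = exp ((c' - d') / x) * (exp 5 * K / x\<^sup>2)"
      using assms by (simp add: exp_add \<kappa>_def)
    finally show ?thesis
      using nonneg \<open>0 < x\<close> \<open>0 < K\<close> unfolding gm eqs
      by (simp add: enn2ereal_ennreal ennreal_leI flip: ennreal_mult)
  qed
qed

text \<open>The integral may vanish, while the previous lemma needs \<open>K > 0\<close>; hence the limit.\<close>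

lemma geom_mean_le:
  assumes "f \<in> Mplus" "v \<in> Mplus" "0 < x"
    and G: "geom_mean (\<lambda>s. 1 / v s) x \<noteq> top"
    and fin: "(\<integral>\<^sup>+t\<in>{0<..<x}. ennreal t * (f t * v t) \<partial>lebesgue) \<noteq> top"
  shows "geom_mean f x \<le> geom_mean (\<lambda>s. 1 / v s) x *
      (ennreal (exp 5 / x\<^sup>2) * (\<integral>\<^sup>+t\<in>{0<..<x}. ennreal t * (f t * v t) \<partial>lebesgue))"
proof -
  define k where "k = enn2real (\<integral>\<^sup>+t\<in>{0<..<x}. ennreal t * (f t * v t) \<partial>lebesgue)"
  have k: "(\<integral>\<^sup>+t\<in>{0<..<x}. ennreal t * (f t * v t) \<partial>lebesgue) = ennreal k" "0 \<le> k"
    using fin by (simp_all add: k_def ennreal_enn2real_if)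
  obtain y where y: "geom_mean (\<lambda>s. 1 / v s) x = ennreal y" "0 \<le> y"
    using G by (metis ennreal_cases)
  have "geom_mean f x \<le> ennreal (y * (exp 5 * (k + 1 / real (Suc n)) / x\<^sup>2))" for n
  proof -
    have "0 < k + 1 / real (Suc n)"
      using k(2) by (simp add: add_nonneg_pos)
    then show ?thesis
      using geom_mean_le_aux[OF assms(1-3) _ G, of "k + 1 / real (Suc n)"] y k
      by (simp add: ennreal_leI flip: ennreal_mult)
  qed
  moreover have "(\<lambda>n. ennreal (y * (exp 5 * (k + 1 / real (Suc n)) / x\<^sup>2)))
      \<longlonglongrightarrow> ennreal (y * (exp 5 * (k + 0) / x\<^sup>2))"
    using LIMSEQ_inverse_real_of_nat \<open>0 < x\<close>
    by (intro tendsto_intros) (auto simp: inverse_eq_divide)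
  ultimately have "geom_mean f x \<le> ennreal (y * (exp 5 * (k + 0) / x\<^sup>2))"
    by (intro LIMSEQ_le_const) auto
  then show ?thesis
    using y k by (simp flip: ennreal_mult)
qed

section \<open>A weighted inequality\<close>

text \<open>Dyadic decomposition: if \<open>x\<close> lies in [2^k t, 2^(k+1) t), the
  \<open>k\<close>-th term alone dominates, the power being decreasing. The intervals start at 0
  because the weight will be controlled on intervals (0,t).\<close>

lemma powr_tail_le_suminf:
  assumes "0 < t" "t < x" "0 < s"
  shows "ennreal (x powr (- 1 - s))
      \<le> (\<Sum>k. ennreal ((2 ^ k * t) powr (- 1 - s)) * indicator {0<..<2 ^ Suc k * t} x)"
proof -
  obtain n where "x / t < 2 ^ n"
    using real_arch_pow[of 2 "x / t"] by auto
  then have "x < 2 ^ n * t"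
    using assms by (simp add: field_simps)
  then have ex: "x < 2 ^ Suc n * t"
    using assms by simp
  define k where "k = (LEAST k. x < 2 ^ Suc k * t)"
  have k: "x < 2 ^ Suc k * t"
    unfolding k_def using ex by (rule LeastI)
  have "2 ^ k * t \<le> x"
  proof (cases k)
    case 0
    then show ?thesis
      using assms by simp
  next
    case (Suc j)
    then have "\<not> x < 2 ^ Suc j * t"
      using not_less_Least[of j "\<lambda>k. x < 2 ^ Suc k * t"] by (simp add: k_def)
    then show ?thesis
      using Suc by simp
  qed
  then have "x powr (- 1 - s) \<le> (2 ^ k * t) powr (- 1 - s)"
    using assms by (intro powr_mono2') auto
  moreover define h where
    "h j = ennreal ((2 ^ j * t) powr (- 1 - s)) * indicator {0<..<2 ^ Suc j * t} x" for j
  ultimately have "ennreal (x powr (- 1 - s)) \<le> h k"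
    using k assms by (simp add: ennreal_leI)
  also have "h k \<le> suminf h"
    using sum_le_suminf[of h "{k}"] by simp
  finally show ?thesis
    by (simp add: h_def[abs_def])
qed

text \<open>This replaces an integration by parts. By \<open>W\<close>, the \<open>k\<close>-th
  dyadic term is at most 2^s B / (2^k t), and these bounds form a geometric series of ratio
  1/2.\<close>

lemma integral_tail_le:
  assumes "w \<in> Mplus" "0 < s" "0 \<le> B" "0 < t"
    and W: "\<And>t. 0 < t \<Longrightarrow> (\<integral>\<^sup>+x\<in>{0<..<t}. w x \<partial>lebesgue) \<le> ennreal (B * t powr s)"
  shows "(\<integral>\<^sup>+x\<in>{t<..}. w x * ennreal (x powr (- 1 - s)) \<partial>lebesgue)
      \<le> ennreal (2 powr (s + 1) * B / t)"
proof -
  note [measurable] = Mplus_interval[OF assms(1)]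
  let ?c = "\<lambda>k::nat. ennreal ((2 ^ k * t) powr (- 1 - s))"
  have "(\<integral>\<^sup>+x\<in>{t<..}. w x * ennreal (x powr (- 1 - s)) \<partial>lebesgue)
      \<le> (\<integral>\<^sup>+x. (\<Sum>k. ?c k * (w x * indicator {0<..<2 ^ Suc k * t} x)) \<partial>lebesgue)"
  proof (rule nn_integral_mono)
    fix x
    have "w x * ennreal (x powr (- 1 - s))
        \<le> w x * (\<Sum>k. ?c k * indicator {0<..<2 ^ Suc k * t} x)" if "t < x"
      using powr_tail_le_suminf[OF \<open>0 < t\<close> that \<open>0 < s\<close>] by (rule mult_left_mono) simp
    then show "w x * ennreal (x powr (- 1 - s)) * indicator {t<..} x
        \<le> (\<Sum>k. ?c k * (w x * indicator {0<..<2 ^ Suc k * t} x))"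
      unfolding mult.left_commute[of _ "w x"] ennreal_suminf_cmult
      by (cases "t < x") simp_all
  qed
  also have "\<dots> = (\<Sum>k. ?c k * (\<integral>\<^sup>+x\<in>{0<..<2 ^ Suc k * t}. w x \<partial>lebesgue))"
    by (subst nn_integral_suminf) (measurable, simp add: nn_integral_cmult)
  also have "\<dots> \<le> (\<Sum>k. ?c k * ennreal (B * (2 ^ Suc k * t) powr s))"
    using \<open>0 < t\<close> by (intro suminf_le mult_left_mono W) auto
  also have "\<dots> = (\<Sum>k. ennreal (2 powr s * B / t * (1 / 2) ^ k))"
  proof (rule suminf_cong)
    fix k
    have "?c k * ennreal (B * (2 ^ Suc k * t) powr s)
        = ennreal ((2 ^ k * t) powr (- 1 - s) * (B * (2 ^ Suc k * t) powr s))"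
      using \<open>0 \<le> B\<close> by (intro ennreal_mult[symmetric]) auto
    also have "(2 ^ k * t) powr (- 1 - s) * (B * (2 ^ Suc k * t) powr s)
        = B * 2 powr s * ((2 ^ k * t) powr (- 1 - s) * (2 ^ k * t) powr s)"
      by (simp only: power_Suc powr_mult mult_ac)
    also have "(2 ^ k * t) powr (- 1 - s) * (2 ^ k * t) powr s = 1 / (2 ^ k * t)"
      using \<open>0 < t\<close> by (simp flip: powr_add add: powr_neg_one)
    also have "B * 2 powr s * (1 / (2 ^ k * t)) = 2 powr s * B / t * (1 / 2) ^ k"
      using \<open>0 < t\<close> by (simp add: field_simps)
    finally show "?c k * ennreal (B * (2 ^ Suc k * t) powr s) = ennreal (2 powr s * B / t * (1 / 2) ^ k)" .
  qed
  also have "\<dots> = ennreal (2 powr s * B / t * 2)"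
  proof (rule suminf_ennreal_eq)
    show "(\<lambda>k. 2 powr s * B / t * (1 / 2) ^ k) sums (2 powr s * B / t * 2)"
      using geometric_sums[of "1 / 2 :: real"] by (intro sums_mult) simp
  qed (use assms in simp)
  also have "2 powr s * B / t * 2 = 2 powr (s + 1) * B / t"
    by (simp add: powr_add)
  finally show ?thesis .
qed

text \<open>After exchanging the integrals, the inner one is a tail of order \<open>B / t\<close>,
  and the factor \<open>t\<close> of the moment cancels the denominator.\<close>

lemma weighted_mean_integral_le:
  assumes "w \<in> Mplus" "F \<in> Mplus" "0 < s" "0 \<le> B"
    and W: "\<And>t. 0 < t \<Longrightarrow> (\<integral>\<^sup>+x\<in>{0<..<t}. w x \<partial>lebesgue) \<le> ennreal (B * t powr s)"
  shows "(\<integral>\<^sup>+x\<in>{0<..}. w x * ennreal (x powr (- 1 - s)) *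
        (\<integral>\<^sup>+t\<in>{0<..<x}. ennreal t * F t \<partial>lebesgue) \<partial>lebesgue)
      \<le> ennreal (2 powr (s + 1) * B) * (\<integral>\<^sup>+t\<in>{0<..}. F t \<partial>lebesgue)"
proof -
  interpret sigma_finite_measure "lebesgue :: real measure"
    by (rule sigma_finite_lebesgue)
  interpret pair_sigma_finite "lebesgue :: real measure" "lebesgue :: real measure" ..
  define w' where "w' x = w x * ennreal (x powr (- 1 - s)) * indicator {0<..} x" for x
  define F' where "F' t = ennreal t * F t * indicator {0<..} t" for t
  have [measurable]: "w' \<in> borel_measurable lebesgue"
    unfolding w'_def
    by (rule Mplus_interval(2)[OF Mplus_mult[OF assms(1) Mplus_borel]]) measurable
  have [measurable]: "F' \<in> borel_measurable lebesgue"
    unfolding F'_def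
    by (rule Mplus_interval(2)[OF Mplus_mult[OF Mplus_borel assms(2)]]) measurable
  note [measurable] = Mplus_interval(2)[OF assms(2)]
  have "(\<integral>\<^sup>+x\<in>{0<..}. w x * ennreal (x powr (- 1 - s)) *
        (\<integral>\<^sup>+t\<in>{0<..<x}. ennreal t * F t \<partial>lebesgue) \<partial>lebesgue)
      = (\<integral>\<^sup>+x. (\<integral>\<^sup>+t. (if t < x then w' x * F' t else 0) \<partial>lebesgue) \<partial>lebesgue)"
  proof (rule nn_integral_cong)
    fix x
    have "(\<integral>\<^sup>+t\<in>{0<..<x}. ennreal t * F t \<partial>lebesgue)
        = (\<integral>\<^sup>+t. (if t < x then F' t else 0) \<partial>lebesgue)"
      by (intro nn_integral_cong) (auto simp: F'_def indicator_def)
    then have "w x * ennreal (x powr (- 1 - s)) *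
        (\<integral>\<^sup>+t\<in>{0<..<x}. ennreal t * F t \<partial>lebesgue) * indicator {0<..} x
        = w' x * (\<integral>\<^sup>+t. (if t < x then F' t else 0) \<partial>lebesgue)"
      by (simp add: w'_def mult_ac)
    also have "\<dots> = (\<integral>\<^sup>+t. w' x * (if t < x then F' t else 0) \<partial>lebesgue)"
      by (rule nn_integral_cmult[symmetric]) measurable
    also have "\<dots> = (\<integral>\<^sup>+t. (if t < x then w' x * F' t else 0) \<partial>lebesgue)"
      by (intro nn_integral_cong) simp
    finally show "w x * ennreal (x powr (- 1 - s)) *
        (\<integral>\<^sup>+t\<in>{0<..<x}. ennreal t * F t \<partial>lebesgue) * indicator {0<..} x
        = (\<integral>\<^sup>+t. (if t < x then w' x * F' t else 0) \<partial>lebesgue)" .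
  qed
  also have "\<dots> = (\<integral>\<^sup>+t. (\<integral>\<^sup>+x. (if t < x then w' x * F' t else 0) \<partial>lebesgue) \<partial>lebesgue)"
    by (rule Fubini'[symmetric]) measurable
  also have "\<dots> \<le> (\<integral>\<^sup>+t. ennreal (2 powr (s + 1) * B) * (F t * indicator {0<..} t) \<partial>lebesgue)"
  proof (rule nn_integral_mono)
    fix t :: real
    show "(\<integral>\<^sup>+x. (if t < x then w' x * F' t else 0) \<partial>lebesgue)
        \<le> ennreal (2 powr (s + 1) * B) * (F t * indicator {0<..} t)"
    proof (cases "0 < t")
      case True
      have "(\<integral>\<^sup>+x. (if t < x then w' x * F' t else 0) \<partial>lebesgue)
          = (\<integral>\<^sup>+x. (if t < x then w' x else 0) * F' t \<partial>lebesgue)"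
        by (intro nn_integral_cong) simp
      also have "\<dots> = (\<integral>\<^sup>+x. (if t < x then w' x else 0) \<partial>lebesgue) * F' t"
        by (rule nn_integral_multc) measurable
      also have "(\<integral>\<^sup>+x. (if t < x then w' x else 0) \<partial>lebesgue)
          = (\<integral>\<^sup>+x\<in>{t<..}. w x * ennreal (x powr (- 1 - s)) \<partial>lebesgue)"
        using True by (intro nn_integral_cong) (auto simp: w'_def indicator_def)
      also have "\<dots> * F' t \<le> ennreal (2 powr (s + 1) * B / t) * F' t"
        using True assms by (intro mult_right_mono integral_tail_le) auto
      also have "\<dots> = (ennreal (2 powr (s + 1) * B / t) * ennreal t) * F t"
        using True by (simp add: F'_def mult_ac)
      also have "ennreal (2 powr (s + 1) * B / t) * ennreal t = ennreal (2 powr (s + 1) * B)"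
        using True assms by (subst ennreal_mult[symmetric]) auto
      finally show ?thesis
        using True by simp
    next
      case False
      then have "F' t = 0"
        by (simp add: F'_def)
      then show ?thesis
        by (simp cong: if_cong)
    qed
  qed
  also have "\<dots> = ennreal (2 powr (s + 1) * B) * (\<integral>\<^sup>+t\<in>{0<..}. F t \<partial>lebesgue)"
    by (rule nn_integral_cmult) measurable
  finally show ?thesis .
qed

section \<open>The characterization\<close>

text \<open>\<open>geom_mean_le\<close> for the function f^p, raised to the power
  \<open>q / p\<close>.\<close>

lemma geom_mean_epowr_le:
  assumes "f \<in> Mplus" "v \<in> Mplus" "0 < x" "0 < p" "p < q"
    and G: "geom_mean (\<lambda>s. 1 / v s) x \<noteq> top"
    and fin: "(\<integral>\<^sup>+t\<in>{0<..<x}. ennreal t * (f t epowr p * v t) \<partial>lebesgue) \<noteq> top"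
  shows "geom_mean f x epowr q \<le> geom_mean (\<lambda>s. 1 / v s) x epowr (q / p) *
      (ennreal ((exp 5 / x\<^sup>2) powr (q / p)) *
       (\<integral>\<^sup>+t\<in>{0<..<x}. ennreal t * (f t epowr p * v t) \<partial>lebesgue) epowr (q / p))"
proof -
  have "(\<lambda>t. f t epowr p) \<in> Mplus"
    using assms(1) measurable_epowr by (rule Mplus_compose)
  then have "geom_mean (\<lambda>t. f t epowr p) x epowr (q / p)
      \<le> (geom_mean (\<lambda>s. 1 / v s) x * (ennreal (exp 5 / x\<^sup>2) *
         (\<integral>\<^sup>+t\<in>{0<..<x}. ennreal t * (f t epowr p * v t) \<partial>lebesgue))) epowr (q / p)"
    using assms by (intro epowr_mono geom_mean_le) auto
  moreover have "geom_mean (\<lambda>t. f t epowr p) x epowr (q / p) = geom_mean f x epowr q"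
    using assms by (simp add: geom_mean_epowr epowr_epowr)
  ultimately show ?thesis
    by (simp add: epowr_mult epowr_ennreal)
qed

lemma moment_le:
  assumes "F \<in> Mplus" "0 < x"
  shows "(\<integral>\<^sup>+t\<in>{0<..<x}. ennreal t * F t \<partial>lebesgue)
      \<le> ennreal x * (\<integral>\<^sup>+t\<in>{0<..}. F t \<partial>lebesgue)"
proof -
  have "(\<integral>\<^sup>+t\<in>{0<..<x}. ennreal t * F t \<partial>lebesgue)
      \<le> (\<integral>\<^sup>+t. ennreal x * (F t * indicator {0<..} t) \<partial>lebesgue)"
    by (intro nn_integral_mono)
      (auto split: split_indicator intro!: mult_right_mono ennreal_leI)
  also have "\<dots> = ennreal x * (\<integral>\<^sup>+t\<in>{0<..}. F t \<partial>lebesgue)"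
    using assms(1) by (intro nn_integral_cmult Mplus_interval)
  finally show ?thesis .
qed

text \<open>Count of the powers of \<open>x\<close>: the two pointwise bounds give
  \<open>- 2 * s\<close>, and replacing moments by \<open>x\<close> times full integrals gives back
  \<open>s - 1\<close>. The total \<open>- 1 - s\<close> is the exponent in
  \<open>weighted_mean_integral_le\<close>.\<close>

lemma integral_geom_mean_le:
  fixes p1 p2 q :: real
  assumes "f \<in> Mplus" "g \<in> Mplus" "u \<in> Mplus" "v1 \<in> Mplus" "v2 \<in> Mplus"
    and p: "0 < p1" "0 < p2" "p1 < q" "p2 < q" and "0 \<le> B"
    and s: "s = q / p1 + q / p2"
    and W: "\<And>t. 0 < t \<Longrightarrow>
      (\<integral>\<^sup>+x\<in>{0<..<t}. geom_mean (\<lambda>s. 1 / v1 s) x epowr (q / p1) *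
          geom_mean (\<lambda>s. 1 / v2 s) x epowr (q / p2) * u x \<partial>lebesgue) \<le> ennreal (B * t powr s)"
    and N1: "N1 = (\<integral>\<^sup>+t\<in>{0<..}. f t epowr p1 * v1 t \<partial>lebesgue)" "N1 \<noteq> top"
    and N2: "N2 = (\<integral>\<^sup>+t\<in>{0<..}. g t epowr p2 * v2 t \<partial>lebesgue)" "N2 \<noteq> top"
  shows "(\<integral>\<^sup>+x\<in>{0<..}. geom_mean f x epowr q * geom_mean g x epowr q * u x \<partial>lebesgue)
      \<le> ennreal (exp 5 powr s * (2 powr (s + 1) * B)) * (N1 epowr (q / p1) * N2 epowr (q / p2))"
proof -
  define G1 where "G1 = geom_mean (\<lambda>s. 1 / v1 s)"
  define G2 where "G2 = geom_mean (\<lambda>s. 1 / v2 s)"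
  define w where "w x = G1 x epowr (q / p1) * G2 x epowr (q / p2) * u x" for x
  define F where "F t = f t epowr p1 * v1 t" for t
  define H where "H t = g t epowr p2 * v2 t" for t
  define K where "K x = (\<integral>\<^sup>+t\<in>{0<..<x}. ennreal t * F t \<partial>lebesgue)" for x
  define c where "c = exp 5 powr s"
  have FH: "F \<in> Mplus" "H \<in> Mplus"
    unfolding F_def H_def using assms
    by (auto intro!: Mplus_mult Mplus_compose[of _ "\<lambda>y. y epowr _"])
  have "G1 \<in> Mplus" "G2 \<in> Mplus"
    unfolding G1_def G2_def using assms by (auto intro!: geom_mean_Mplus Mplus_one_divide)
  then have w: "w \<in> Mplus"
    unfolding w_def using assms(3) by (auto intro!: Mplus_mult Mplus_compose[of _ "\<lambda>y. y epowr _"])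
  \<comment> \<open>By \<open>W\<close>, \<open>w\<close> has finite integral over each of countably
    many intervals exhausting the half-line, so it is finite almost everywhere.\<close>
  have "AE x in lebesgue. w x * indicator {0<..<real n + 1} x \<noteq> \<infinity>" for n
  proof (rule nn_integral_noteq_infinite)
    show "(\<lambda>x. w x * indicator {0<..<real n + 1} x) \<in> borel_measurable lebesgue"
      using w by (rule Mplus_interval)
    show "(\<integral>\<^sup>+x\<in>{0<..<real n + 1}. w x \<partial>lebesgue) \<noteq> \<infinity>"
      using W[of "real n + 1"] by (auto simp: w_def G1_def G2_def top_unique)
  qed
  then have "AE x in lebesgue. \<forall>n. w x * indicator {0<..<real n + 1} x \<noteq> \<infinity>"
    by (simp add: AE_all_countable)
  then have w_fin: "AE x in lebesgue. 0 < x \<longrightarrow> w x \<noteq> top"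
  proof eventually_elim
    case (elim x)
    obtain n where "x \<le> real n"
      using real_arch_simple by blast
    then have "x < real n + 1"
      by simp
    then show ?case
      using elim[rule_format, of n] by auto
  qed
  have pointwise: "geom_mean f x epowr q * geom_mean g x epowr q * u x
      \<le> (ennreal c * (N1 epowr (q / p1 - 1) * N2 epowr (q / p2))) * (w x * ennreal (x powr (- 1 - s)) * K x)"
    if x: "0 < x" "w x \<noteq> top" for x
  proof -
    have K_le: "K x \<le> ennreal x * N1"
      unfolding K_def N1(1) F_def[symmetric] using FH(1) x(1) by (rule moment_le)
    have L_le: "(\<integral>\<^sup>+t\<in>{0<..<x}. ennreal t * H t \<partial>lebesgue) \<le> ennreal x * N2" (is "?L \<le> _")
      unfolding N2(1) H_def[symmetric] using FH(2) x(1) by (rule moment_le)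
    have fin: "ennreal x * N1 \<noteq> top" "ennreal x * N2 \<noteq> top"
      using N1 N2 by (simp_all add: ennreal_mult_eq_top_iff)
    have le1: "geom_mean f x epowr q
        \<le> G1 x epowr (q / p1) * (ennreal ((exp 5 / x\<^sup>2) powr (q / p1)) * K x epowr (q / p1))"
      if "G1 x \<noteq> top"
      using that fin K_le assms x unfolding G1_def K_def F_def
      by (intro geom_mean_epowr_le) (auto simp: top_unique)
    have le2: "geom_mean g x epowr q
        \<le> G2 x epowr (q / p2) * (ennreal ((exp 5 / x\<^sup>2) powr (q / p2)) * ?L epowr (q / p2))"
      if "G2 x \<noteq> top"
      using that fin L_le assms x unfolding G2_def H_def
      by (intro geom_mean_epowr_le) (auto simp: top_unique)
    \<comment> \<open>A finite \<open>w x\<close> can still hide an infinite factor next to a zero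
      one. A zero among \<open>u x\<close>, \<open>G1 x\<close>, \<open>G2 x\<close> makes the
      left-hand side 0, by \<open>le1\<close> or \<open>le2\<close> for the means.\<close>
    consider "u x = 0" | "G1 x = 0" | "G2 x = 0" | "G1 x \<noteq> top" "G2 x \<noteq> top"
      using x by (auto simp: w_def ennreal_mult_eq_top_iff)
    then show ?thesis
    proof cases
      case 2
      then have "geom_mean f x epowr q = 0"
        using le1 by simp
      then show ?thesis
        by simp
    next
      case 3
      then have "geom_mean g x epowr q = 0"
        using le2 by simp
      then show ?thesis
        by simp
    next
      case 4
      \<comment> \<open>Here \<open>p1 < q\<close> enters: the exponent \<open>q / p1 - 1\<close> is
        positive, so \<open>K_le\<close> can be raised to it.\<close>
      have "K x epowr (q / p1) = K x * K x epowr (q / p1 - 1)"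
        using epowr_add[of "K x" 1 "q / p1 - 1"] by simp
      also have "\<dots> \<le> K x * (ennreal (x powr (q / p1 - 1)) * N1 epowr (q / p1 - 1))"
        using epowr_mono[OF K_le, of "q / p1 - 1"] p x
        by (intro mult_left_mono) (simp_all add: epowr_mult epowr_ennreal)
      finally have K_powr: "K x epowr (q / p1)
          \<le> K x * (ennreal (x powr (q / p1 - 1)) * N1 epowr (q / p1 - 1))" .
      have L_powr: "?L epowr (q / p2) \<le> ennreal (x powr (q / p2)) * N2 epowr (q / p2)"
        using epowr_mono[OF L_le, of "q / p2"] p x
        by (simp add: epowr_mult epowr_ennreal)
      have "geom_mean f x epowr q * geom_mean g x epowr q * u x
          \<le> (G1 x epowr (q / p1) * (ennreal ((exp 5 / x\<^sup>2) powr (q / p1)) *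
              (K x * (ennreal (x powr (q / p1 - 1)) * N1 epowr (q / p1 - 1))))) *
            (G2 x epowr (q / p2) * (ennreal ((exp 5 / x\<^sup>2) powr (q / p2)) *
              (ennreal (x powr (q / p2)) * N2 epowr (q / p2)))) * u x"
        using 4
        by (intro mult_mono mult_left_mono order_trans[OF le1] order_trans[OF le2] K_powr L_powr) auto
      also have "\<dots> = (ennreal ((exp 5 / x\<^sup>2) powr (q / p1)) * ennreal ((exp 5 / x\<^sup>2) powr (q / p2)) *
            (ennreal (x powr (q / p1 - 1)) * ennreal (x powr (q / p2)))) *
          (N1 epowr (q / p1 - 1) * N2 epowr (q / p2)) * (w x * K x)"
        by (simp only: w_def mult_ac)
      also have "ennreal ((exp 5 / x\<^sup>2) powr (q / p1)) * ennreal ((exp 5 / x\<^sup>2) powr (q / p2)) *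
            (ennreal (x powr (q / p1 - 1)) * ennreal (x powr (q / p2)))
          = ennreal ((exp 5 / x\<^sup>2) powr s * x powr (s - 1))"
        by (simp add: s add_diff_eq diff_add_eq flip: ennreal_mult powr_add)
      also have "(exp 5 / x\<^sup>2) powr s * x powr (s - 1) = c * x powr (- 1 - s)"
      proof -
        have "(exp 5 / x\<^sup>2) powr s = c * x powr (- 2 * s)"
          using x by (simp add: c_def powr_divide powr_minus_divide powr_powr flip: powr_numeral)
        moreover have "x powr (- 2 * s) * x powr (s - 1) = x powr (- 1 - s)"
          unfolding powr_add[symmetric] by (rule arg_cong[of _ _ "(powr) x"]) simp
        ultimately show ?thesis
          by (simp only: mult.assoc)
      qed
      also have "ennreal (c * x powr (- 1 - s)) = ennreal c * ennreal (x powr (- 1 - s))"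
        by (simp add: c_def ennreal_mult)
      finally show ?thesis
        by (simp only: mult_ac)
    qed simp
  qed
  have [measurable]: "(\<lambda>x. w x * ennreal (x powr (- 1 - s)) * K x * indicator {0<..} x)
      \<in> borel_measurable lebesgue"
  proof -
    have [measurable]: "K \<in> borel_measurable lebesgue"
      unfolding K_def by (intro measurable_integral_upto Mplus_mult Mplus_borel FH) simp
    note [measurable] = Mplus_interval(2)[OF w]
    have "(\<lambda>x. (w x * indicator {0<..} x) * ennreal (x powr (- 1 - s)) * K x) \<in> borel_measurable lebesgue"
      by measurable
    then show ?thesis
      by (simp only: mult_ac)
  qed
  have "(\<integral>\<^sup>+x\<in>{0<..}. geom_mean f x epowr q * geom_mean g x epowr q * u x \<partial>lebesgue)
      \<le> (\<integral>\<^sup>+x. (ennreal c * (N1 epowr (q / p1 - 1) * N2 epowr (q / p2))) *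
          (w x * ennreal (x powr (- 1 - s)) * K x * indicator {0<..} x) \<partial>lebesgue)"
    using w_fin
  proof (intro nn_integral_mono_AE, eventually_elim)
    case (elim x)
    then show ?case
      using pointwise[of x] by (cases "0 < x") (simp_all add: mult.assoc)
  qed
  also have "\<dots> = (ennreal c * (N1 epowr (q / p1 - 1) * N2 epowr (q / p2))) *
      (\<integral>\<^sup>+x\<in>{0<..}. w x * ennreal (x powr (- 1 - s)) * K x \<partial>lebesgue)"
    by (rule nn_integral_cmult) measurable
  also have "\<dots> \<le> (ennreal c * (N1 epowr (q / p1 - 1) * N2 epowr (q / p2))) *
      (ennreal (2 powr (s + 1) * B) * N1)"
  proof (rule mult_left_mono)
    have "0 < s"
      using p by (simp add: s add_pos_pos)
    moreover have "(\<integral>\<^sup>+x\<in>{0<..<t}. w x \<partial>lebesgue) \<le> ennreal (B * t powr s)" if "0 < t" for t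
      using W[OF that] by (simp only: w_def G1_def G2_def)
    ultimately show "(\<integral>\<^sup>+x\<in>{0<..}. w x * ennreal (x powr (- 1 - s)) * K x \<partial>lebesgue)
        \<le> ennreal (2 powr (s + 1) * B) * N1"
      unfolding K_def N1(1) F_def[symmetric]
      by (intro weighted_mean_integral_le w FH(1) \<open>0 \<le> B\<close>)
  qed simp
  also have "\<dots> = (ennreal c * ennreal (2 powr (s + 1) * B)) *
      ((N1 epowr 1 * N1 epowr (q / p1 - 1)) * N2 epowr (q / p2))"
    by (simp only: epowr_1 mult_ac)
  also have "N1 epowr 1 * N1 epowr (q / p1 - 1) = N1 epowr (q / p1)"
    by (simp only: epowr_add) simp
  also have "ennreal c * ennreal (2 powr (s + 1) * B) = ennreal (exp 5 powr s * (2 powr (s + 1) * B))"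
    using \<open>0 \<le> B\<close> by (simp add: c_def flip: ennreal_mult)
  finally show ?thesis .
qed

section \<open>Test functions and the equivalence\<close>

text \<open>The p-th power of the test function times \<open>v\<close> is at most 1 on (0,t). It is
  0 instead of 1 where \<open>v\<close> is 0 or \<infinity>, hence an inequality.\<close>

lemma weighted_norm_test_function_le:
  assumes "0 < p" "0 < t" "v \<in> Mplus"
  shows "weighted_norm p v (\<lambda>s. (1 / v s * indicator {0<..<t} s) epowr (1 / p))
      \<le> ennreal (t powr (1 / p))"
proof -
  have le: "1 / y * y \<le> 1" for y :: ennreal
  proof (cases "y = 0 \<or> y = top")
    case False
    then have "y / y = 1"
      by (intro ennreal_divide_self) (auto simp: less_top)
    then show ?thesis
      by (simp add: divide_ennreal_def mult.commute)
  qed auto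
  have "(\<integral>\<^sup>+x\<in>{0<..}. ((1 / v x * indicator {0<..<t} x) epowr (1 / p)) epowr p * v x \<partial>lebesgue)
      \<le> (\<integral>\<^sup>+x. indicator {0<..<t} x \<partial>lebesgue)"
    using assms(1) by (intro nn_integral_mono) (auto simp: epowr_epowr indicator_def le)
  also have "\<dots> = ennreal t"
    using assms(2) by simp
  finally have "weighted_norm p v (\<lambda>s. (1 / v s * indicator {0<..<t} s) epowr (1 / p))
      \<le> ennreal t epowr (1 / p)"
    unfolding weighted_norm_def using assms(1) by (intro epowr_mono) simp_all
  then show ?thesis
    using assms(2) by (simp add: epowr_ennreal)
qed

theorem theorem4p1:
  fixes p1 p2 q :: real and u v1 v2 :: "real \<Rightarrow> ennreal"
  assumes "p1 > 0" and "p2 > 0" and "1 < max p1 p2" and "max p1 p2 < q"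
    and "u \<in> Mplus" and "v1 \<in> Mplus" and "v2 \<in> Mplus"
  shows "(\<exists>C::real. C > 0 \<and>
           (\<forall>f\<in>Mplus. \<forall>g\<in>Mplus.
              \<not> indeterminate_product (weighted_norm p1 v1 f) (weighted_norm p2 v2 g) \<longrightarrow>
              (\<integral>\<^sup>+x\<in>{0<..}. (geom_mean f x epowr q) * (geom_mean g x epowr q) * u x \<partial>lebesgue)
                 epowr (1 / q)
              \<le> ennreal C * (weighted_norm p1 v1 f * weighted_norm p2 v2 g)))
     \<longleftrightarrow>
         (SUP t\<in>{0<..}. ennreal (t powr (- (1 / p1 + 1 / p2))) *
            (\<integral>\<^sup>+x\<in>{0<..<t}. (geom_mean (\<lambda>s. 1 / v1 s) x epowr (q / p1)) *
                            (geom_mean (\<lambda>s. 1 / v2 s) x epowr (q / p2)) * u x \<partial>lebesgue)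
              epowr (1 / q))
         < \<infinity>"
    (is "?ineq \<longleftrightarrow> (SUP t\<in>{0<..}. ennreal (t powr (- ?\<sigma>)) * ?W t epowr (1 / q)) < \<infinity>")
proof
  assume ?ineq
  then obtain C where C: "0 < C" and ineq: "\<And>f g. f \<in> Mplus \<Longrightarrow> g \<in> Mplus \<Longrightarrow>
      \<not> indeterminate_product (weighted_norm p1 v1 f) (weighted_norm p2 v2 g) \<Longrightarrow>
      (\<integral>\<^sup>+x\<in>{0<..}. geom_mean f x epowr q * geom_mean g x epowr q * u x \<partial>lebesgue) epowr (1 / q)
        \<le> ennreal C * (weighted_norm p1 v1 f * weighted_norm p2 v2 g)"
    by blast
  have "ennreal (t powr (- ?\<sigma>)) * ?W t epowr (1 / q) \<le> ennreal C" if "0 < t" for t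
  proof -
    define f where "f p v s = (1 / v s * indicator {0<..<t} s) epowr (1 / p)"
      for p and v :: "real \<Rightarrow> ennreal" and s
    have f: "f p v \<in> Mplus" if "v \<in> Mplus" for p v
    proof -
      have "(\<lambda>s. 1 / v s * indicator {0<..<t} s) \<in> Mplus"
        using Mplus_one_divide[OF that] by (rule Mplus_mult) (intro Mplus_borel borel_measurable_indicator, simp)
      then show ?thesis
        unfolding f_def using measurable_epowr by (rule Mplus_compose)
    qed
    have norm: "weighted_norm p v (f p v) \<le> ennreal (t powr (1 / p))" if "0 < p" "v \<in> Mplus" for p v
      unfolding f_def using that \<open>0 < t\<close> by (intro weighted_norm_test_function_le)
    \<comment> \<open>For \<open>x < t\<close> the mean over (0,x) does not see the cut-off at
      \<open>t\<close>.\<close>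
    have gm: "geom_mean (f p v) x epowr q = geom_mean (\<lambda>s. 1 / v s) x epowr (q / p)"
      if "0 < p" "v \<in> Mplus" "0 < x" "x < t" for p v x
    proof -
      have "geom_mean (f p v) x = geom_mean (\<lambda>s. (1 / v s) epowr (1 / p)) x"
        using that by (intro geom_mean_cong) (simp add: f_def)
      also have "\<dots> = geom_mean (\<lambda>s. 1 / v s) x epowr (1 / p)"
        using that by (intro geom_mean_epowr Mplus_one_divide) auto
      finally show ?thesis
        by (simp add: epowr_epowr)
    qed
    have "?W t \<le> (\<integral>\<^sup>+x\<in>{0<..}. geom_mean (f p1 v1) x epowr q * geom_mean (f p2 v2) x epowr q * u x \<partial>lebesgue)"
      using assms by (intro nn_integral_mono) (auto split: split_indicator simp: gm)
    then have "?W t epowr (1 / q) \<le> (\<integral>\<^sup>+x\<in>{0<..}. geom_mean (f p1 v1) x epowr q *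
        geom_mean (f p2 v2) x epowr q * u x \<partial>lebesgue) epowr (1 / q)"
      using assms by (intro epowr_mono) auto
    also have "\<dots> \<le> ennreal C * (weighted_norm p1 v1 (f p1 v1) * weighted_norm p2 v2 (f p2 v2))"
    proof (rule ineq)
      \<comment> \<open>An indeterminate product needs an infinite factor, and both norms are
        finite.\<close>
      have "weighted_norm p1 v1 (f p1 v1) < top" "weighted_norm p2 v2 (f p2 v2) < top"
        using assms by (auto intro!: le_less_trans[OF norm])
      then show "\<not> indeterminate_product (weighted_norm p1 v1 (f p1 v1)) (weighted_norm p2 v2 (f p2 v2))"
        by (auto simp: indeterminate_product_def)
    qed (use assms in \<open>auto intro!: f\<close>)
    also have "\<dots> \<le> ennreal C * (ennreal (t powr (1 / p1)) * ennreal (t powr (1 / p2)))"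
      using assms by (intro mult_left_mono mult_mono norm) auto
    also have "\<dots> = ennreal (C * t powr ?\<sigma>)"
      using C by (simp add: powr_add ennreal_mult)
    finally have "ennreal (t powr (- ?\<sigma>)) * ?W t epowr (1 / q)
        \<le> ennreal (t powr (- ?\<sigma>)) * ennreal (C * t powr ?\<sigma>)"
      by (rule mult_left_mono) simp
    also have "\<dots> = ennreal (t powr (- ?\<sigma>) * (C * t powr ?\<sigma>))"
      using C by (intro ennreal_mult[symmetric]) auto
    also have "t powr (- ?\<sigma>) * (C * t powr ?\<sigma>) = C"
      using \<open>0 < t\<close> by (simp only: powr_minus) simp
    finally show ?thesis .
  qed
  then have "(SUP t\<in>{0<..}. ennreal (t powr (- ?\<sigma>)) * ?W t epowr (1 / q)) \<le> ennreal C"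
    by (intro SUP_least) auto
  then show "(SUP t\<in>{0<..}. ennreal (t powr (- ?\<sigma>)) * ?W t epowr (1 / q)) < \<infinity>"
    by (rule le_less_trans) simp
next
  define s where "s = q / p1 + q / p2"
  have p: "p1 < q" "p2 < q" "0 < q" "q \<noteq> 0"
    using assms by auto
  assume "(SUP t\<in>{0<..}. ennreal (t powr (- ?\<sigma>)) * ?W t epowr (1 / q)) < \<infinity>"
  then obtain S where S: "(SUP t\<in>{0<..}. ennreal (t powr (- ?\<sigma>)) * ?W t epowr (1 / q)) = ennreal S"
    and "0 \<le> S"
    unfolding infinity_ennreal_def less_top_ennreal by blast
  \<comment> \<open>The supremum bound solved for the integral; it is the hypothesis of
    \<open>integral_geom_mean_le\<close> with \<open>B = S powr q\<close>, since
    \<open>?\<sigma> * q = s\<close>.\<close>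
  have W: "?W t \<le> ennreal (S powr q * t powr s)" if "0 < t" for t
  proof -
    have "ennreal (t powr (- ?\<sigma>)) * ?W t epowr (1 / q) \<le> ennreal S"
      unfolding S[symmetric] using that by (intro SUP_upper) simp
    then have "ennreal (t powr ?\<sigma>) * (ennreal (t powr (- ?\<sigma>)) * ?W t epowr (1 / q))
        \<le> ennreal (t powr ?\<sigma>) * ennreal S"
      by (rule mult_left_mono) simp
    also have "ennreal (t powr ?\<sigma>) * (ennreal (t powr (- ?\<sigma>)) * ?W t epowr (1 / q)) = ?W t epowr (1 / q)"
    proof -
      have "ennreal (t powr ?\<sigma>) * ennreal (t powr (- ?\<sigma>)) = 1"
        using that by (simp only: powr_minus ennreal_mult[symmetric] powr_ge_zero inverse_nonnegative_iff_nonnegative) simp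
      then show ?thesis
        by (simp only: mult.assoc[symmetric] mult_1_left)
    qed
    also have "ennreal (t powr ?\<sigma>) * ennreal S = ennreal (t powr ?\<sigma> * S)"
      using \<open>0 \<le> S\<close> by (intro ennreal_mult[symmetric]) auto
    finally have "(?W t epowr (1 / q)) epowr q \<le> ennreal (t powr ?\<sigma> * S) epowr q"
      using p by (intro epowr_mono) auto
    also have "\<dots> = ennreal ((t powr ?\<sigma> * S) powr q)"
      using \<open>0 \<le> S\<close> by (intro epowr_ennreal) simp
    also have "(t powr ?\<sigma> * S) powr q = S powr q * t powr s"
    proof -
      have "?\<sigma> * q = s"
        by (simp add: s_def distrib_right)
      then show ?thesis
        by (simp only: powr_mult powr_powr mult.commute)
    qed
    finally show ?thesis
      using p by (simp add: epowr_epowr)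
  qed
  \<comment> \<open>The constant of \<open>integral_geom_mean_le\<close> for
    \<open>B = S powr q\<close>. As \<open>S\<close> may be 0, so may \<open>D\<close>; adding 1 to
    its root below keeps the final constant positive.\<close>
  define D where "D = exp 5 powr s * (2 powr (s + 1) * S powr q)"
  have ineq: "(\<integral>\<^sup>+x\<in>{0<..}. geom_mean f x epowr q * geom_mean g x epowr q * u x \<partial>lebesgue) epowr (1 / q)
      \<le> ennreal (D powr (1 / q) + 1) * (weighted_norm p1 v1 f * weighted_norm p2 v2 g)" (is "?lhs epowr _ \<le> _")
    if f: "f \<in> Mplus" and g: "g \<in> Mplus"
      and det: "\<not> indeterminate_product (weighted_norm p1 v1 f) (weighted_norm p2 v2 g)" for f g
  proof -
    define N1 where "N1 = (\<integral>\<^sup>+t\<in>{0<..}. f t epowr p1 * v1 t \<partial>lebesgue)"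
    define N2 where "N2 = (\<integral>\<^sup>+t\<in>{0<..}. g t epowr p2 * v2 t \<partial>lebesgue)"
    have norms: "weighted_norm p1 v1 f = N1 epowr (1 / p1)" "weighted_norm p2 v2 g = N2 epowr (1 / p2)"
      by (simp_all add: weighted_norm_def N1_def N2_def)
    \<comment> \<open>If one norm is infinite, the other is nonzero by \<open>det\<close>; the
      product is then \<open>top\<close>, and so is the right-hand side because its constant is
      positive.\<close>
    show ?thesis
    proof (cases "N1 = top \<or> N2 = top")
      case True
      then have "N1 epowr (1 / p1) * N2 epowr (1 / p2) = top"
        using det by (auto simp: norms indeterminate_product_def ennreal_mult_eq_top_iff)
      then show ?thesis
        by (simp add: norms ennreal_mult_top add_nonneg_eq_0_iff)
    next
      case False
      have "?lhs \<le> ennreal D * (N1 epowr (q / p1) * N2 epowr (q / p2))"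
        unfolding D_def using assms p f g False W
        by (intro integral_geom_mean_le[OF _ _ _ _ _ _ _ _ _ _ s_def _ N1_def _ N2_def]) auto
      then have "?lhs epowr (1 / q) \<le> (ennreal D * (N1 epowr (q / p1) * N2 epowr (q / p2))) epowr (1 / q)"
        using p by (intro epowr_mono) auto
      also have "\<dots> = ennreal (D powr (1 / q)) * (N1 epowr (1 / p1) * N2 epowr (1 / p2))"
        using p by (simp add: epowr_mult epowr_epowr epowr_ennreal D_def)
      also have "\<dots> \<le> ennreal (D powr (1 / q) + 1) * (N1 epowr (1 / p1) * N2 epowr (1 / p2))"
        by (intro mult_right_mono ennreal_leI) auto
      finally show ?thesis
        by (simp add: norms)
    qed
  qed
  show ?ineq
    using ineq by (intro exI[of _ "D powr (1 / q) + 1"]) (auto intro: add_nonneg_pos)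
qed

end
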